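(* Let $\boldsymbol f\in\mathbb R^{NM}$, $\tau>0$, $p=1$ (so $q=\infty$), and let $\mathcal C\subseteq\mathbb R^{NM}$ be a nonempty closed convex set with orthogonal projection $P_{\mathcal C}$. Let $\widehat{\boldsymbol J_K}:\mathbb R^{NM}\to\mathcal X=\mathbb R^{N\times LM\times2}$ be the weighted patch-based Jacobian with adjoint $\widehat{\boldsymbol J_K}^{*}$, let $B_{\infty,\infty}=\{\boldsymbol\Phi\in\mathcal X:\|\boldsymbol\Phi(n)\|_{\mathcal S_\infty}\le1,\ n=1,\dots,N\}$ with orthogonal projection $P_{B_{\infty,\infty}}$, and let $$d(\boldsymbol\Phi)=\min_{\boldsymbol u\in\mathcal C}\Big\{\tfrac12\|\boldsymbol u-\boldsymbol f\|_2^2+\tau\langle\widehat{\boldsymbol J_K}^{*}\boldsymbol\Phi,\boldsymbol u\rangle_2\Big\}.$$ Let $\boldsymbol\Phi_0=\boldsymbol\Theta_1=\boldsymbol 0$, $t_1=1$, and for $i\ge1$ define $$\boldsymbol z_i=P_{\mathcal C}(\boldsymbol f-\tau\widehat{\boldsymbol J_K}^{*}\boldsymbol\Theta_i),\quad \boldsymbol\Phi_i=P_{B_{\infty,\infty}}\Big(\boldsymbol\Theta_i+\tfrac{1}{8\sqrt2\,\tau}\widehat{\boldsymbol J_K}\boldsymbol z_i\Big),\quad t_{i+1}=\tfrac{1+\sqrt{1+4t_i^2}}{2},\quad \boldsymbol\Theta_{i+1}=\boldsymbol\Phi_i+\tfrac{t_i-1}{t_{i+1}}(\boldsymbol\Phi_i-\boldsymbol\Phi_{i-1}).$$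 Then for every maximizer $\boldsymbol\Phi^{*}$ of $d$ over $B_{\infty,\infty}$ and every $i\ge1$, $$d(\boldsymbol\Phi^{*})-d(\boldsymbol\Phi_i)\le\frac{2L(d)\,\|\boldsymbol\Phi_0-\boldsymbol\Phi^{*}\|_{\mathcal X}^2}{(i+1)^2},\qquad L(d)=8\sqrt2\,\tau^2 .$$ In particular the method has complexity $O(1/i^2)$.
   Context: Images: $\boldsymbol u=(\boldsymbol u_1,\dots,\boldsymbol u_M)\in\mathbb R^{NM}$ is an image with $M$ channels, each channel $\boldsymbol u_m\in\mathbb R^N$ being a function on a rectangular pixel grid with $N$ pixels $x_1,\dots,x_N\in\mathbb Z^2$. $\nabla\boldsymbol u_m=(\nabla_x\boldsymbol u_m,\nabla_y\boldsymbol u_m)$ is the discrete gradient, obtained by forward differences with step $1$ in the two axis directions, a difference being set to $0$ when the forward neighbour is outside the grid; thus $\nabla\boldsymbol u_m(i)\in\mathbb R^2$. Weights: $\mathcal W$ acts on vector fields on the grid by pointwise multiplication by the diagonal matrix $\operatorname{diag}(\boldsymbol w_1,\boldsymbol w_2)$, where $\boldsymbol w_1=\frac{1}{1+\kappa|\boldsymbol G_{\hat\sigma}*\nabla_x\boldsymbol f|}$ and $\boldsymbol w_2=\frac{1}{1+\kappa|\boldsymbol G_{\hat\sigma}*\nabla_y\boldsymbol f|}$ (evaluated pixelwise; for several channels, on channel $m$ with $\boldsymbol f_m$ in place of $\boldsymbol f$). Here $\kappa\ge0$ and $\hat\sigma>0$ are parameters and $\boldsymbol G_{\hat\sigma}*$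 is Gaussian convolution of variance $\hat\sigma$. $\boldsymbol f$ is fixed, so $\mathcal W$ is a fixed linear operator. Weighted translations: $K$ is a Gaussian convolution kernel on $\{-L_K,\dots,L_K\}^2$ (positive, invariant under sign change of each coordinate, entries summing to $1$), $L=(2L_K+1)^2$, and $g_1,\dots,g_L$ enumerate $\{-L_K,\dots,L_K\}^2$. For a vector field $v$ on the grid, $(\Psi_l v)(i)=\sqrt{K[g_l]}\,v(x_i-g_l)$, $l=1,\dots,L$, where values of $v$ at points outside the grid are assigned by one fixed standard boundary convention (zero extension, periodic extension, or half-sample symmetric reflection). Weighted patch-based Jacobian: $\widehat{\boldsymbol J_K}:\mathbb R^{NM}\to\mathcal X=\mathbb R^{N\times LM\times 2}$ is the linear map such that for each pixel $i$, $(\widehat{\boldsymbol J_K}\boldsymbol u)(i)\in\mathbb R^{LM\times2}$ is the matrix whose row with index $h=(m-1)L+l$ is $(\Psi_l\mathcal W\nabla\boldsymbol u_m)(i)$, $1\le m\le M$, $1\le l\le L$. Norms: elements $\boldsymbol\Phi\in\mathcal X$ consist of $N$ submatrices $\boldsymbol\Phi(n)\in\mathbb R^{LM\times2}$; $\langle\boldsymbol\Lambda,\boldsymbol\Upsilon\rangle_{\mathcal X}=\sum_{n=1}^N\operatorname{trace}(\boldsymbol\Upsilon(n)^T\boldsymbol\Lambda(n))$ and $\|\boldsymbol\Upsilon\|_{\mathcal X}=\sqrt{\langle\boldsymbol\Upsilon,\boldsymbol\Upsilon\rangle_{\mathcal X}}$. $\|\cdot\|_{\mathcal S_\infty}$ is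 the Schatten norm of order $\infty$ (largest singular value). The adjoint $\widehat{\boldsymbol J_K}^{*}:\mathcal X\to\mathbb R^{NM}$ is taken with respect to $\langle\cdot,\cdot\rangle_{\mathcal X}$ and the Euclidean inner product $\langle\cdot,\cdot\rangle_2$ on $\mathbb R^{NM}$; projections onto $\mathcal C$ and $B_{\infty,\infty}$ are with respect to the corresponding norms. *)

theory Defs
  imports "HOL-Analysis.Analysis" "HOL-Library.Landau_Symbols"
begin

text \<open>
  Pixels are indexed by a finite type \<open>'n\<close> and placed in the integer plane by an injection \<open>pos\<close>
  whose range is \<open>rect a b\<close>.  An image with channels \<open>'m\<close> is \<open>u :: real^'n^'m\<close>, and
  \<open>u $ m\<close> is its channel \<open>m\<close>; a vector field is \<open>v :: (real^2)^'n\<close>.  The patch offsets are indexed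
  by a finite type \<open>'l\<close>.  An element of the space \<open>\<X>\<close> is \<open>\<Phi> :: real^2^('m \<times> 'l)^'n\<close>, so that
  \<open>\<Phi> $ n\<close> is the submatrix at pixel \<open>n\<close>; the pair \<open>(m, l)\<close> stands for the row number \<open>(m - 1) L + l\<close>.
  The library inner products and norms on these types are the Euclidean ones; see
  \<open>inner_eq_sum_trace\<close> below for \<open>\<X>\<close>.
\<close>

definition rect :: "int \<times> int \<Rightarrow> int \<times> int \<Rightarrow> (int \<times> int) set" where
  "rect a b = {fst a..fst b} \<times> {snd a..snd b}"

definition is_grid :: "int \<times> int \<Rightarrow> int \<times> int \<Rightarrow> ('n::finite \<Rightarrow> int \<times> int) \<Rightarrow> bool" where
  "is_grid a b pos \<longleftrightarrow> bij_betw pos UNIV (rect a b)"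


subsection \<open>Boundary conventions\<close>

datatype boundary = Zero_Extension | Periodic_Extension | Symmetric_Extension

definition wrap :: "int \<Rightarrow> int \<Rightarrow> int \<Rightarrow> int" where
  "wrap a b y = a + (y - a) mod (b - a + 1)"

text \<open>Half-sample symmetry: reflection about \<open>a - 1/2\<close> and \<open>b + 1/2\<close>, so that the edge pixels are
  repeated and the extension has period \<open>2 (b - a + 1)\<close>.\<close>

definition reflect :: "int \<Rightarrow> int \<Rightarrow> int \<Rightarrow> int" where
  "reflect a b y =
     (let n = b - a + 1; r = (y - a) mod (2 * n)
      in a + (if r < n then r else 2 * n - 1 - r))"

definition extend ::
    "boundary \<Rightarrow> int \<times> int \<Rightarrow> int \<times> int \<Rightarrow> ('n::finite \<Rightarrow> int \<times> int) \<Rightarrow>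
     ('b::zero)^'n \<Rightarrow> int \<times> int \<Rightarrow> 'b" where
  "extend bc a b pos v y =
     (case bc of
        Zero_Extension \<Rightarrow> (if y \<in> rect a b then v $ inv pos y else 0)
      | Periodic_Extension \<Rightarrow>
          v $ inv pos (wrap (fst a) (fst b) (fst y), wrap (snd a) (snd b) (snd y))
      | Symmetric_Extension \<Rightarrow>
          v $ inv pos (reflect (fst a) (fst b) (fst y), reflect (snd a) (snd b) (snd y)))"


subsection \<open>Discrete gradient\<close>

definition forward_diff ::
    "int \<times> int \<Rightarrow> ('n::finite \<Rightarrow> int \<times> int) \<Rightarrow> real^'n \<Rightarrow> real^'n" where
  "forward_diff e pos w =
     (\<chi> i. if pos i + e \<in> range pos then w $ inv pos (pos i + e) - w $ i else 0)"

definition grad :: "('n::finite \<Rightarrow> int \<times> int) \<Rightarrow> real^'n \<Rightarrow> (real^2)^'n" where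
  "grad pos w =
     (\<chi> i. vector [forward_diff (1, 0) pos w $ i, forward_diff (0, 1) pos w $ i])"


subsection \<open>Gaussian convolution and weights\<close>

text \<open>The sampled Gaussian of variance \<open>s\<close>, normalised on the window of radius \<open>R\<close>;
  \<open>R = \<infinity>\<close> means no truncation.  Any other normalisation only rescales the parameter \<open>\<kappa>\<close> of the
  weights.\<close>

definition window :: "enat \<Rightarrow> (int \<times> int) set" where
  "window R = {k. enat (nat \<bar>fst k\<bar>) \<le> R \<and> enat (nat \<bar>snd k\<bar>) \<le> R}"

definition gauss :: "real \<Rightarrow> int \<times> int \<Rightarrow> real" where
  "gauss s k = exp (- ((of_int (fst k))\<^sup>2 + (of_int (snd k))\<^sup>2) / (2 * s))"

definition gaussian_kernel :: "real \<Rightarrow> enat \<Rightarrow> int \<times> int \<Rightarrow> real" where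
  "gaussian_kernel s R k = gauss s k / (\<Sum>\<^sub>\<infinity>j\<in>window R. gauss s j)"

definition gaussian_conv ::
    "real \<Rightarrow> enat \<Rightarrow> boundary \<Rightarrow> int \<times> int \<Rightarrow> int \<times> int \<Rightarrow> ('n::finite \<Rightarrow> int \<times> int) \<Rightarrow>
     real^'n \<Rightarrow> real^'n" where
  "gaussian_conv s R bc a b pos w =
     (\<chi> i. \<Sum>\<^sub>\<infinity>k\<in>window R. gaussian_kernel s R k * extend bc a b pos w (pos i - k))"

text \<open>Entry \<open>$ m $ i\<close> holds the diagonal of the weight matrix at pixel \<open>i\<close> of channel \<open>m\<close>.\<close>

definition weights ::
    "real \<Rightarrow> real \<Rightarrow> enat \<Rightarrow> boundary \<Rightarrow> int \<times> int \<Rightarrow> int \<times> int \<Rightarrow> ('n::finite \<Rightarrow> int \<times> int) \<Rightarrow>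
     real^'n^'m \<Rightarrow> (real^2)^'n^'m" where
  "weights \<kappa> s R bc a b pos f =
     (\<chi> m i. vector
        [1 / (1 + \<kappa> * \<bar>gaussian_conv s R bc a b pos (forward_diff (1, 0) pos (f $ m)) $ i\<bar>),
         1 / (1 + \<kappa> * \<bar>gaussian_conv s R bc a b pos (forward_diff (0, 1) pos (f $ m)) $ i\<bar>)])"

definition apply_weights :: "(real^2)^'n \<Rightarrow> (real^2)^'n \<Rightarrow> (real^2)^'n" where
  "apply_weights w v = (\<chi> i c. w $ i $ c * v $ i $ c)"


subsection \<open>Weighted patch-based Jacobian\<close>

definition offsets :: "nat \<Rightarrow> (int \<times> int) set" where
  "offsets LK = {- int LK..int LK} \<times> {- int LK..int LK}"

text \<open>The kernel is constrained only by the properties of a Gaussian window that matter, so that no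
  particular discretisation of the Gaussian is imposed; \<open>patch_kernel_gaussian\<close> covers the sampled
  one.\<close>

definition patch_kernel :: "nat \<Rightarrow> (int \<times> int \<Rightarrow> real) \<Rightarrow> bool" where
  "patch_kernel LK K \<longleftrightarrow>
     (\<forall>k\<in>offsets LK. K k > 0) \<and>
     (\<forall>(x, y)\<in>offsets LK. K (- x, y) = K (x, y) \<and> K (x, - y) = K (x, y)) \<and>
     (\<Sum>k\<in>offsets LK. K k) = 1"

lemma window_enat: "window (enat LK) = offsets LK"
  by (auto simp: window_def offsets_def)

lemma patch_kernel_gaussian: "patch_kernel LK (gaussian_kernel s (enat LK))"
proof -
  have fin: "finite (offsets LK)" and ne: "offsets LK \<noteq> {}"
    by (auto simp: offsets_def)
  have pos: "(\<Sum>j\<in>offsets LK. gauss s j) > 0"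
    using fin ne by (intro sum_pos) (auto simp: gauss_def)
  show ?thesis
    using fin pos
    by (auto simp: patch_kernel_def gaussian_kernel_def window_enat gauss_def
        simp flip: sum_divide_distrib)
qed

definition weighted_translation ::
    "boundary \<Rightarrow> int \<times> int \<Rightarrow> int \<times> int \<Rightarrow> ('n::finite \<Rightarrow> int \<times> int) \<Rightarrow>
     (int \<times> int \<Rightarrow> real) \<Rightarrow> int \<times> int \<Rightarrow> (real^2)^'n \<Rightarrow> (real^2)^'n" where
  "weighted_translation bc a b pos K k v =
     (\<chi> i. sqrt (K k) *\<^sub>R extend bc a b pos v (pos i - k))"

definition patch_jacobian ::
    "boundary \<Rightarrow> int \<times> int \<Rightarrow> int \<times> int \<Rightarrow> ('n::finite \<Rightarrow> int \<times> int) \<Rightarrow>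
     (int \<times> int \<Rightarrow> real) \<Rightarrow> ('l::finite \<Rightarrow> int \<times> int) \<Rightarrow> (real^2)^'n^'m \<Rightarrow>
     real^'n^('m::finite) \<Rightarrow> real^2^('m \<times> 'l)^'n" where
  "patch_jacobian bc a b pos K g w u =
     (\<chi> i h. weighted_translation bc a b pos K (g (snd h))
                (apply_weights (w $ fst h) (grad pos (u $ fst h))) $ i)"


subsection \<open>Norms, unit ball and dual objective\<close>

lemma inner_eq_sum_trace:
  fixes \<Lambda> \<Upsilon> :: "real^2^('r::finite)^('n::finite)"
  shows "\<Lambda> \<bullet> \<Upsilon> = (\<Sum>n\<in>UNIV. trace (transpose (\<Upsilon> $ n) ** (\<Lambda> $ n)))"
  by (simp add: inner_vec_def trace_def matrix_matrix_mult_def transpose_def sum.swap[of _ "UNIV :: 2 set"]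
      mult.commute)

text \<open>Singular values are the square roots of the eigenvalues of \<open>A\<^sup>T A\<close>.  If \<open>A\<close> has fewer
  rows than columns this adds a zero, which does not affect the largest one.\<close>

definition singular_values :: "real^'c^'r \<Rightarrow> real set" where
  "singular_values A =
     {sqrt \<mu> | \<mu>. \<exists>x. x \<noteq> 0 \<and> (transpose A ** A) *v x = \<mu> *\<^sub>R x}"

definition schatten_inf :: "real^'c^'r \<Rightarrow> real" where
  "schatten_inf A = Max (singular_values A)"

definition B_inf_inf :: "(real^2^('r::finite)^('n::finite)) set" where
  "B_inf_inf = {\<Phi>. \<forall>n. schatten_inf (\<Phi> $ n) \<le> 1}"

definition dual_objective ::
    "('u::euclidean_space) set \<Rightarrow> 'u \<Rightarrow> real \<Rightarrow> ('u \<Rightarrow> 'x::euclidean_space) \<Rightarrow> 'x \<Rightarrow> real" where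
  "dual_objective C f \<tau> J \<Phi> =
     (INF u\<in>C. 1/2 * (norm (u - f))\<^sup>2 + \<tau> * (adjoint J \<Phi> \<bullet> u))"

text \<open>The infimum is a minimum.\<close>

lemma dual_objective_is_min:
  fixes C :: "('u::euclidean_space) set" and J :: "'u \<Rightarrow> 'x::euclidean_space"
  assumes "closed C" "C \<noteq> {}"
  obtains u where "u \<in> C"
    "dual_objective C f \<tau> J \<Phi> = 1/2 * (norm (u - f))\<^sup>2 + \<tau> * (adjoint J \<Phi> \<bullet> u)"
    "\<And>v. v \<in> C \<Longrightarrow> dual_objective C f \<tau> J \<Phi> \<le> 1/2 * (norm (v - f))\<^sup>2 + \<tau> * (adjoint J \<Phi> \<bullet> v)"
proof -
  define q where "q = adjoint J \<Phi>"
  define F where "F = (\<lambda>u. 1/2 * (norm (u - f))\<^sup>2 + \<tau> * (q \<bullet> u))"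
  define p where "p = f - \<tau> *\<^sub>R q"
  define u where "u = closest_point C p"
  have F: "F v = 1/2 * (dist p v)\<^sup>2 + (\<tau> * (q \<bullet> f) - 1/2 * \<tau>\<^sup>2 * (q \<bullet> q))" for v
    unfolding F_def p_def dist_norm power2_norm_eq_inner
    by (simp add: algebra_simps inner_commute power2_eq_square)
  have u: "u \<in> C"
    unfolding u_def by (rule closest_point_in_set[OF assms])
  have le: "F u \<le> F v" if "v \<in> C" for v
  proof -
    have "dist p u \<le> dist p v"
      unfolding u_def by (rule closest_point_le[OF assms(1) that])
    then have "(dist p u)\<^sup>2 \<le> (dist p v)\<^sup>2"
      by (simp add: power_mono)
    then show ?thesis by (simp add: F)
  qed
  have "(INF u\<in>C. F u) = F u"
    using u le by (intro cInf_eq_minimum) auto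
  then have "dual_objective C f \<tau> J \<Phi> = F u"
    by (simp add: dual_objective_def F_def q_def)
  then show ?thesis
    using that[OF u] le by (simp add: F_def q_def)
qed

end

theory Submission
  imports Defs
begin

text \<open>
  The iteration is accelerated projected gradient descent (FISTA) for the convex function \<open>- d\<close> on
  the Schatten ball, so the theorem needs three things: that the ball is a closed convex set, that
  \<open>- d\<close> is convex with an \<open>L(d)\<close>-Lipschitz gradient, and the rate of FISTA.

  The Schatten norm is the operator norm (\<open>schatten_inf_eq_onorm\<close>), because the maximum of
  \<open>norm (A x)\<close> on the unit sphere is attained at an eigenvector of the Gram matrix.  The ball is then
  an intersection of preimages of Euclidean balls under linear maps.

  No derivative of \<open>d\<close> is ever taken.  Since \<open>d\<close> is a minimum over \<open>u\<close> of functions affine in \<open>\<Phi>\<close>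
  and 1-strongly convex in \<open>u\<close>, with minimiser \<open>z\<close> at \<open>\<Theta>\<close>, it satisfies
  \[ 0 \le d(\Theta) + \tau \langle J z, \Psi - \Theta\rangle - d(\Psi)
       \le \frac{c \tau^2}{2} \|\Psi - \Theta\|^2 \]
  whenever \<open>(norm (J u))\<^sup>2 \<le> c (norm u)\<^sup>2\<close> (\<open>dual_objective_bounds\<close>).  These two inequalities are all
  that the analysis of Beck and Teboulle uses (\<open>fista_convergence_rate\<close>).

  It remains to bound the Jacobian, with \<open>c = 8 \<le> 8 sqrt 2\<close> (\<open>norm_patch_jacobian\<close>).  The gradient
  contributes the factor 8 and the weights at most 1.  The patch does not increase
  the norm either, but the reason depends on the boundary convention: for zero and periodic
  extension each single translation is nonexpansive, whereas a translation of the symmetric extension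
  may repeat pixels and enlarge the norm.  There the symmetry of the kernel is decisive: the
  translations by \<open>k\<close> and \<open>- k\<close> in one coordinate together visit every pixel exactly twice
  (\<open>sum_reflect\<close>), so that the average over the patch preserves the norm
  (\<open>patch_average_extend_le\<close>).
\<close>

section \<open>Accelerated projected gradient descent\<close>

text \<open>The optimality of the projection turns the linearisation at \<open>\<Theta>\<close> into a bound on the progress
  towards an arbitrary point \<open>x\<close> of the set; \<open>\<Theta>\<close> may lie outside the set, as extrapolated
  points do.\<close>

lemma projected_step_inequality:
  fixes h :: "'x::euclidean_space \<Rightarrow> real" and G :: 'x
  assumes B: "convex B" "closed B" and L: "L > 0"
    and lower: "\<And>\<Psi>. h \<Psi> \<ge> h \<Theta> + G \<bullet> (\<Psi> - \<Theta>)"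
    and upper: "\<And>\<Psi>. h \<Psi> \<le> h \<Theta> + G \<bullet> (\<Psi> - \<Theta>) + L / 2 * (norm (\<Psi> - \<Theta>))\<^sup>2"
    and p: "p = closest_point B (\<Theta> - (1 / L) *\<^sub>R G)" and x: "x \<in> B"
  shows "2 / L * (h x - h p) \<ge> (norm (p - x))\<^sup>2 - (norm (\<Theta> - x))\<^sup>2"
proof -
  have "(\<Theta> - (1 / L) *\<^sub>R G - p) \<bullet> (x - p) \<le> 0"
    unfolding p by (rule closest_point_dot[OF B x])
  then have "L * ((\<Theta> - (1 / L) *\<^sub>R G - p) \<bullet> (x - p)) \<le> 0"
    using L by (simp add: mult_le_0_iff)
  then have *: "L * ((\<Theta> - p) \<bullet> (x - p)) \<le> G \<bullet> (x - p)"
    using L by (simp add: inner_diff_left right_diff_distrib)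
  have "h x - h p \<ge> G \<bullet> (x - p) - L / 2 * (norm (p - \<Theta>))\<^sup>2"
    using lower[of x] upper[of p] by (simp add: inner_diff_right)
  with * have "h x - h p \<ge> L * ((\<Theta> - p) \<bullet> (x - p)) - L / 2 * (norm (p - \<Theta>))\<^sup>2"
    by linarith
  also have "L * ((\<Theta> - p) \<bullet> (x - p)) - L / 2 * (norm (p - \<Theta>))\<^sup>2 =
      L / 2 * ((norm (p - x))\<^sup>2 - (norm (\<Theta> - x))\<^sup>2)"
    unfolding power2_norm_eq_inner by (simp add: algebra_simps inner_commute)
  finally have "2 / L * (L / 2 * ((norm (p - x))\<^sup>2 - (norm (\<Theta> - x))\<^sup>2)) \<le> 2 / L * (h x - h p)"
    using L by (intro mult_left_mono) auto
  also have "2 / L * (L / 2 * ((norm (p - x))\<^sup>2 - (norm (\<Theta> - x))\<^sup>2)) =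
      (norm (p - x))\<^sup>2 - (norm (\<Theta> - x))\<^sup>2"
    using L by (simp add: mult.assoc[symmetric])
  finally show ?thesis .
qed

lemma fista_step_size_properties:
  fixes t :: "nat \<Rightarrow> real"
  assumes t1: "t 1 = 1"
    and t: "\<And>i. i \<ge> 1 \<Longrightarrow> t (i + 1) = (1 + sqrt (1 + 4 * (t i)\<^sup>2)) / 2"
    and i: "i \<ge> 1"
  shows "(t (i + 1))\<^sup>2 - t (i + 1) = (t i)\<^sup>2" and "t i \<ge> (real i + 1) / 2"
proof -
  have "(2 * t (i + 1) - 1)\<^sup>2 = 1 + 4 * (t i)\<^sup>2"
    unfolding t[OF i] by (simp add: field_simps)
  then show "(t (i + 1))\<^sup>2 - t (i + 1) = (t i)\<^sup>2"
    by (simp add: power2_eq_square algebra_simps)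
  show "t i \<ge> (real i + 1) / 2"
    using i
  proof (induction i rule: dec_induct)
    case base
    then show ?case using t1 by simp
  next
    case (step i)
    have "2 * t i \<le> sqrt (1 + 4 * (t i)\<^sup>2)"
      by (rule real_le_rsqrt) (simp add: power2_eq_square)
    then show ?case using step t[of i] by simp
  qed
qed

text \<open>The energy \<open>E j\<close> in the proof, a weighted gap plus the squared distance to \<open>x\<close> of an extrapolated
  point, does not increase.  Its gap carries the weight \<open>(t j)\<^sup>2\<close>, which grows quadratically, and that
  is the whole source of the rate.\<close>

theorem fista_convergence_rate:
  fixes h :: "'x::euclidean_space \<Rightarrow> real" and G :: "'x \<Rightarrow> 'x"
  assumes B: "convex B" "closed B" and L: "L > 0"
    and lower: "\<And>\<Theta> \<Psi>. h \<Psi> \<ge> h \<Theta> + G \<Theta> \<bullet> (\<Psi> - \<Theta>)"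
    and upper: "\<And>\<Theta> \<Psi>. h \<Psi> \<le> h \<Theta> + G \<Theta> \<bullet> (\<Psi> - \<Theta>) + L / 2 * (norm (\<Psi> - \<Theta>))\<^sup>2"
    and init: "\<Theta> 1 = \<Phi> 0" "t 1 = 1"
    and Phi: "\<And>i. i \<ge> 1 \<Longrightarrow> \<Phi> i = closest_point B (\<Theta> i - (1 / L) *\<^sub>R G (\<Theta> i))"
    and t: "\<And>i. i \<ge> 1 \<Longrightarrow> t (i + 1) = (1 + sqrt (1 + 4 * (t i)\<^sup>2)) / 2"
    and Theta: "\<And>i. i \<ge> 1 \<Longrightarrow>
      \<Theta> (i + 1) = \<Phi> i + ((t i - 1) / t (i + 1)) *\<^sub>R (\<Phi> i - \<Phi> (i - 1))"
    and x: "x \<in> B" and i: "i \<ge> 1"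
  shows "h (\<Phi> i) - h x \<le> 2 * L * (norm (\<Phi> 0 - x))\<^sup>2 / (real i + 1)\<^sup>2"
proof -
  have descent: "2 / L * (h y - h (\<Phi> j)) \<ge> (norm (\<Phi> j - y))\<^sup>2 - (norm (\<Theta> j - y))\<^sup>2"
    if "y \<in> B" "j \<ge> 1" for y j
    by (rule projected_step_inequality[OF B L lower upper Phi[OF that(2)] that(1)])
  have mem: "\<Phi> j \<in> B" if "j \<ge> 1" for j
    unfolding Phi[OF that] using closest_point_in_set[OF B(2)] x by blast
  define u where "u j = t j *\<^sub>R \<Phi> j - (t j - 1) *\<^sub>R \<Phi> (j - 1) - x" for j
  define E where "E j = 2 / L * (t j)\<^sup>2 * (h (\<Phi> j) - h x) + (norm (u j))\<^sup>2" for j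
  have "E i \<le> (norm (\<Phi> 0 - x))\<^sup>2"
    using i
  proof (induction i rule: dec_induct)
    case base
    show ?case
      using descent[OF x, of 1] init by (simp add: E_def u_def right_diff_distrib)
  next
    case (step j)
    \<comment> \<open>The progress inequality is used for \<open>\<Phi> j\<close> and for \<open>x\<close>, with weights \<open>T\<^sup>2 - T = (t j)\<^sup>2\<close> and \<open>T\<close>.
      The extrapolation rule makes the squared norms collapse to a difference of two terms.\<close>
    define T where "T = t (j + 1)"
    define p where "p = \<Phi> (j + 1)"
    define q where "q = \<Theta> (j + 1)"
    have TT: "T\<^sup>2 - T = (t j)\<^sup>2" and T1: "T \<ge> 1"
      using fista_step_size_properties[OF init(2) t, of j]
        fista_step_size_properties(2)[OF init(2) t, of "j + 1"] step.hyps
      by (auto simp: T_def)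
    have "T *\<^sub>R q = T *\<^sub>R \<Phi> j + (t j - 1) *\<^sub>R (\<Phi> j - \<Phi> (j - 1))"
      using T1 unfolding q_def Theta[OF step.hyps(1)] T_def[symmetric] by (simp add: scaleR_add_right)
    then have uj: "u j = T *\<^sub>R q - (T - 1) *\<^sub>R \<Phi> j - x"
      by (simp add: u_def algebra_simps)
    have uj1: "u (j + 1) = T *\<^sub>R p - (T - 1) *\<^sub>R \<Phi> j - x"
      by (simp add: u_def T_def p_def)
    have 1: "(norm (p - \<Phi> j))\<^sup>2 - (norm (q - \<Phi> j))\<^sup>2 \<le> 2 / L * (h (\<Phi> j) - h p)"
      unfolding p_def q_def by (rule descent[OF mem[OF step.hyps(1)]]) simp
    have 2: "(norm (p - x))\<^sup>2 - (norm (q - x))\<^sup>2 \<le> 2 / L * (h x - h p)"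
      unfolding p_def q_def by (rule descent[OF x]) simp
    have "(norm (u (j + 1)))\<^sup>2 - (norm (u j))\<^sup>2 =
        (T\<^sup>2 - T) * ((norm (p - \<Phi> j))\<^sup>2 - (norm (q - \<Phi> j))\<^sup>2)
        + T * ((norm (p - x))\<^sup>2 - (norm (q - x))\<^sup>2)"
      unfolding uj uj1 power2_norm_eq_inner
      by (simp add: algebra_simps inner_commute power2_eq_square)
    also have "\<dots> \<le> (T\<^sup>2 - T) * (2 / L * (h (\<Phi> j) - h p)) + T * (2 / L * (h x - h p))"
      using 1 2 T1 TT by (intro add_mono mult_left_mono) auto
    also have "\<dots> = 2 / L * (T\<^sup>2 - T) * (h (\<Phi> j) - h x) - 2 / L * T\<^sup>2 * (h p - h x)"
      using L by (simp add: field_simps)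
    finally have "E (j + 1) \<le> E j"
      unfolding E_def TT T_def[symmetric] p_def[symmetric] by simp
    then show ?case using step.IH by simp
  qed
  then have *: "2 / L * (t i)\<^sup>2 * (h (\<Phi> i) - h x) \<le> (norm (\<Phi> 0 - x))\<^sup>2"
    unfolding E_def by (smt (verit) zero_le_power2)
  have ti: "t i \<ge> (real i + 1) / 2"
    by (rule fista_step_size_properties(2)[OF init(2) t i])
  then have t2: "(t i)\<^sup>2 \<ge> ((real i + 1) / 2)\<^sup>2"
    by (intro power_mono) auto
  have tpos: "(t i)\<^sup>2 > 0"
    using ti by (simp add: power2_eq_square)
  have "h (\<Phi> i) - h x \<le> L / 2 * (norm (\<Phi> 0 - x))\<^sup>2 / (t i)\<^sup>2"
    using * L tpos by (simp add: field_simps)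
  also have "\<dots> \<le> L / 2 * (norm (\<Phi> 0 - x))\<^sup>2 / ((real i + 1) / 2)\<^sup>2"
    using t2 L tpos by (intro divide_left_mono mult_pos_pos) auto
  also have "\<dots> = 2 * L * (norm (\<Phi> 0 - x))\<^sup>2 / (real i + 1)\<^sup>2"
    by (simp add: power_divide)
  finally show ?thesis .
qed

section \<open>Smoothness of the dual objective\<close>

text \<open>The first bound says that \<open>\<tau> J z\<close> is a supergradient of the dual objective at \<open>\<Theta>\<close>: insert \<open>z\<close>
  into the minimum defining the left-hand side.  For the second, strong convexity yields the extra
  term \<open>1/2 (norm (u - z))\<^sup>2\<close>, which absorbs the mixed term \<open>\<tau> (J (u - z) \<bullet> (\<Psi> - \<Theta>))\<close>.\<close>

lemma dual_objective_bounds: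
  fixes C :: "('u::euclidean_space) set" and J :: "'u \<Rightarrow> 'x::euclidean_space"
  assumes C: "C \<noteq> {}" "closed C" "convex C" and J: "linear J"
    and c_pos: "c > 0" and bound: "\<And>u. (norm (J u))\<^sup>2 \<le> c * (norm u)\<^sup>2"
    and z: "z = closest_point C (f - \<tau> *\<^sub>R adjoint J \<Theta>)"
  shows "dual_objective C f \<tau> J \<Psi> \<le> dual_objective C f \<tau> J \<Theta> + \<tau> * (J z \<bullet> (\<Psi> - \<Theta>))"
    and "dual_objective C f \<tau> J \<Psi> \<ge> dual_objective C f \<tau> J \<Theta> + \<tau> * (J z \<bullet> (\<Psi> - \<Theta>))
      - c * \<tau>\<^sup>2 / 2 * (norm (\<Psi> - \<Theta>))\<^sup>2"
proof -
  let ?d = "dual_objective C f \<tau> J"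
  define F where "F \<Psi> u = 1/2 * (norm (u - f))\<^sup>2 + \<tau> * (adjoint J \<Psi> \<bullet> u)" for \<Psi> u
  have adj: "adjoint J y \<bullet> u = y \<bullet> J u" for y u
    using adjoint_works[OF J, of u y] by (simp add: inner_commute)
  have zC: "z \<in> C"
    unfolding z using C by (intro closest_point_in_set)
  have growth: "F \<Theta> u \<ge> F \<Theta> z + 1/2 * (norm (u - z))\<^sup>2" if "u \<in> C" for u
  proof -
    have "(f - \<tau> *\<^sub>R adjoint J \<Theta> - z) \<bullet> (u - z) \<le> 0"
      unfolding z by (rule closest_point_dot[OF C(3,2) that])
    moreover have "F \<Theta> u - F \<Theta> z - 1/2 * (norm (u - z))\<^sup>2 = - ((f - \<tau> *\<^sub>R adjoint J \<Theta> - z) \<bullet> (u - z))"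
      unfolding F_def power2_norm_eq_inner by (simp add: algebra_simps inner_commute)
    ultimately show ?thesis by linarith
  qed
  have is_min: "\<exists>u\<in>C. ?d \<Psi> = F \<Psi> u" and le: "\<And>u. u \<in> C \<Longrightarrow> ?d \<Psi> \<le> F \<Psi> u" for \<Psi>
    using dual_objective_is_min[OF C(2,1), of f \<tau> J \<Psi>] unfolding F_def by metis+
  have d\<Theta>: "?d \<Theta> = F \<Theta> z"
  proof -
    obtain u where "u \<in> C" "?d \<Theta> = F \<Theta> u" using is_min by blast
    then have "F \<Theta> z \<le> ?d \<Theta>" using growth[of u] zero_le_power2[of "norm (u - z)"] by linarith
    then show ?thesis using le[OF zC] by (intro antisym)
  qed
  have shift: "F \<Psi> u = F \<Theta> u + \<tau> * (J u \<bullet> (\<Psi> - \<Theta>))" for u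
    unfolding F_def adj by (simp add: inner_diff_right inner_commute right_diff_distrib)
  show "?d \<Psi> \<le> ?d \<Theta> + \<tau> * (J z \<bullet> (\<Psi> - \<Theta>))"
    using le[OF zC, of \<Psi>] by (simp add: shift[of z] d\<Theta>)
  obtain u where u: "u \<in> C" "?d \<Psi> = F \<Psi> u" using is_min by blast
  define D where "D = \<Psi> - \<Theta>"
  define w where "w = u - z"
  have Ju: "J u = J z + J w"
    using J by (simp add: w_def linear_diff)
  \<comment> \<open>Young's inequality, with the constant that the norm of \<open>J\<close> dictates.\<close>
  have young: "0 \<le> (norm w)\<^sup>2 + 2 * \<tau> * (J w \<bullet> D) + c * \<tau>\<^sup>2 * (norm D)\<^sup>2"
  proof -
    have "0 \<le> (norm (J w + (c * \<tau>) *\<^sub>R D))\<^sup>2" by simp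
    also have "\<dots> = (norm (J w))\<^sup>2 + 2 * c * \<tau> * (J w \<bullet> D) + c\<^sup>2 * \<tau>\<^sup>2 * (norm D)\<^sup>2"
      unfolding power2_norm_eq_inner by (simp add: algebra_simps inner_commute power2_eq_square)
    also have "\<dots> \<le> c * (norm w)\<^sup>2 + 2 * c * \<tau> * (J w \<bullet> D) + c\<^sup>2 * \<tau>\<^sup>2 * (norm D)\<^sup>2"
      using bound[of w] by simp
    also have "\<dots> = c * ((norm w)\<^sup>2 + 2 * \<tau> * (J w \<bullet> D) + c * \<tau>\<^sup>2 * (norm D)\<^sup>2)"
      by (simp add: algebra_simps power2_eq_square)
    finally show ?thesis using c_pos by (simp add: zero_le_mult_iff)
  qed
  have "?d \<Psi> \<ge> ?d \<Theta> + 1/2 * (norm w)\<^sup>2 + \<tau> * (J z \<bullet> D) + \<tau> * (J w \<bullet> D)"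
    using growth[OF u(1)] by (simp add: u(2) shift[of u] d\<Theta> Ju D_def w_def algebra_simps)
  then show "?d \<Psi> \<ge> ?d \<Theta> + \<tau> * (J z \<bullet> (\<Psi> - \<Theta>)) - c * \<tau>\<^sup>2 / 2 * (norm (\<Psi> - \<Theta>))\<^sup>2"
    using young unfolding D_def[symmetric] by simp
qed

section \<open>The Schatten ball\<close>

lemma gram_matrix_inner:
  fixes A :: "real^'c^'r"
  shows "((transpose A ** A) *v x) \<bullet> y = (A *v x) \<bullet> (A *v y)"
  by (simp add: dot_lmul_matrix flip: matrix_vector_mul_assoc)

text \<open>Finiteness gives the maximum in the Schatten norm its meaning.  Eigenvectors of a symmetric
  matrix for distinct eigenvalues are orthogonal, hence linearly independent.\<close>

lemma finite_singular_values: "finite (singular_values A)"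
proof -
  define S where "S = transpose A ** A"
  define M where "M = {\<mu>. \<exists>x. x \<noteq> 0 \<and> S *v x = \<mu> *\<^sub>R x}"
  have sym: "(S *v x) \<bullet> y = x \<bullet> (S *v y)" for x y
    by (metis S_def gram_matrix_inner inner_commute)
  have "\<forall>\<mu>\<in>M. \<exists>x. x \<noteq> 0 \<and> S *v x = \<mu> *\<^sub>R x" by (simp add: M_def)
  then obtain e where "\<forall>\<mu>\<in>M. e \<mu> \<noteq> 0 \<and> S *v e \<mu> = \<mu> *\<^sub>R e \<mu>"
    using bchoice[of M "\<lambda>\<mu> x. x \<noteq> 0 \<and> S *v x = \<mu> *\<^sub>R x"] by blast
  then have e: "e \<mu> \<noteq> 0" "S *v e \<mu> = \<mu> *\<^sub>R e \<mu>" if "\<mu> \<in> M" for \<mu>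
    using that by blast+
  have orth: "e \<mu> \<bullet> e \<nu> = 0" if "\<mu> \<in> M" "\<nu> \<in> M" "\<mu> \<noteq> \<nu>" for \<mu> \<nu>
    using sym[of "e \<mu>" "e \<nu>"] e that by simp
  have "inj_on e M"
    by (rule inj_onI) (metis orth e(1) inner_eq_zero_iff)
  moreover have "finite (e ` M)"
  proof (rule independent_imp_finite, rule pairwise_orthogonal_independent)
    show "pairwise orthogonal (e ` M)"
      unfolding pairwise_image pairwise_def orthogonal_def using orth by auto
    show "0 \<notin> e ` M" using e by auto
  qed
  ultimately have "finite M" by (rule finite_imageD[rotated])
  moreover have "singular_values A = sqrt ` M"
    by (auto simp: singular_values_def M_def S_def)
  ultimately show ?thesis by simp
qed

text \<open>Let \<open>x\<close> maximise \<open>norm (A x)\<close> on the unit sphere, with square \<open>\<mu>\<close>.  The quadratic form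
  \<open>\<mu> (norm y)\<^sup>2 - (norm (A y))\<^sup>2\<close> is nonnegative and vanishes at \<open>x\<close>, so its gradient there vanishes
  too; this is the eigenvalue equation.\<close>

lemma onorm_is_singular_value:
  fixes A :: "real^'c^'r"
  shows "onorm ((*v) A) \<in> singular_values A"
proof -
  have "\<exists>x\<in>sphere (0::real^'c) 1. \<forall>y\<in>sphere 0 1. norm (A *v y) \<le> norm (A *v x)"
    by (intro continuous_attains_sup continuous_intros) auto
  then obtain x where x: "norm x = 1" and max: "\<And>y. norm y = 1 \<Longrightarrow> norm (A *v y) \<le> norm (A *v x)"
    by auto
  define \<mu> where "\<mu> = (norm (A *v x))\<^sup>2"
  have le: "norm (A *v y) \<le> norm (A *v x) * norm y" for y
  proof (cases "y = 0")
    case False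
    have "norm (A *v (y /\<^sub>R norm y)) \<le> norm (A *v x)"
      using False by (intro max) simp
    then show ?thesis
      using False by (simp add: matrix_vector_mult_scaleR field_simps)
  qed simp
  define r where "r = \<mu> *\<^sub>R x - (transpose A ** A) *v x"
  define c where "c = \<mu> * (norm r)\<^sup>2 - (norm (A *v r))\<^sup>2"
  have sq: "0 \<le> \<mu> * (norm y)\<^sup>2 - (norm (A *v y))\<^sup>2" for y
    using power_mono[OF le[of y], of 2] by (simp add: \<mu>_def power_mult_distrib)
  have xr: "(A *v x) \<bullet> (A *v r) = r \<bullet> ((transpose A ** A) *v x)"
    by (metis gram_matrix_inner inner_commute)
  have quad: "0 \<le> 2 * \<epsilon> * (norm r)\<^sup>2 + \<epsilon>\<^sup>2 * c" for \<epsilon>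
  proof -
    have "\<mu> * (norm (x + \<epsilon> *\<^sub>R r))\<^sup>2 - (norm (A *v (x + \<epsilon> *\<^sub>R r)))\<^sup>2 =
        (\<mu> * (norm x)\<^sup>2 - \<mu>) + 2 * \<epsilon> * (\<mu> * (x \<bullet> r) - (A *v x) \<bullet> (A *v r)) + \<epsilon>\<^sup>2 * c"
      unfolding c_def \<mu>_def power2_norm_eq_inner
      by (simp add: matrix_vector_right_distrib matrix_vector_mult_scaleR algebra_simps inner_commute
          power2_eq_square)
    also have "\<mu> * (x \<bullet> r) - (A *v x) \<bullet> (A *v r) = (norm r)\<^sup>2"
      unfolding xr power2_norm_eq_inner
      by (subst (3) r_def) (simp add: inner_diff_right inner_commute)
    finally show ?thesis using sq[of "x + \<epsilon> *\<^sub>R r"] x by simp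
  qed
  have "r = 0"
  proof (rule ccontr)
    assume "r \<noteq> 0"
    then have r: "(norm r)\<^sup>2 > 0" by simp
    have c: "c \<ge> 0" unfolding c_def by (rule sq)
    \<comment> \<open>A step against \<open>r\<close> short enough for the first-order term to dominate; \<open>c + 1\<close> avoids
      dividing by zero.\<close>
    define \<epsilon> where "\<epsilon> = (norm r)\<^sup>2 / (c + 1)"
    have e: "\<epsilon> > 0" "\<epsilon> * (c + 1) = (norm r)\<^sup>2" using r c by (auto simp: \<epsilon>_def)
    have "0 \<le> - 2 * \<epsilon> * (\<epsilon> * (c + 1)) + \<epsilon>\<^sup>2 * c" using quad[of "- \<epsilon>"] e(2) by simp
    also have "\<dots> = - (\<epsilon>\<^sup>2 * (c + 2))" by (simp add: algebra_simps power2_eq_square)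
    finally show False using e(1) c by (simp add: mult_le_0_iff)
  qed
  then have "(transpose A ** A) *v x = \<mu> *\<^sub>R x" by (simp add: r_def)
  moreover have "x \<noteq> 0" using x by auto
  ultimately have "sqrt \<mu> \<in> singular_values A" by (auto simp: singular_values_def)
  moreover have "onorm ((*v) A) = norm (A *v x)"
    using onorm_le[of "(*v) A", OF le] onorm[of "(*v) A" x] x
    by (simp add: matrix_vector_mul_bounded_linear)
  ultimately show ?thesis by (simp add: \<mu>_def)
qed

lemma schatten_inf_eq_onorm: "schatten_inf A = onorm ((*v) A)"
  unfolding schatten_inf_def
proof (rule Max_eqI[OF finite_singular_values _ onorm_is_singular_value])
  fix \<sigma> assume "\<sigma> \<in> singular_values A"
  then obtain \<mu> x where \<sigma>: "\<sigma> = sqrt \<mu>" and x: "x \<noteq> 0" "(transpose A ** A) *v x = \<mu> *\<^sub>R x"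
    by (auto simp: singular_values_def)
  have "(norm (A *v x))\<^sup>2 = \<mu> * (norm x)\<^sup>2"
    by (metis gram_matrix_inner inner_scaleR_left power2_norm_eq_inner x(2))
  then have "norm (A *v x) = \<sigma> * norm x"
    by (metis \<sigma> real_sqrt_mult real_sqrt_abs abs_norm_cancel)
  then show "\<sigma> \<le> onorm ((*v) A)"
    using onorm[of "(*v) A" x] x(1) by (simp add: matrix_vector_mul_bounded_linear)
qed

lemma B_inf_inf_eq_vimage:
  "B_inf_inf = (\<Inter>n. \<Inter>x. (\<lambda>\<Phi> :: real^2^'r::finite^'n::finite. \<Phi> $ n *v x) -` cball 0 (norm x))"
proof -
  have "schatten_inf A \<le> 1 \<longleftrightarrow> (\<forall>x. norm (A *v x) \<le> norm x)" for A :: "real^2^'r"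
    unfolding schatten_inf_eq_onorm
  proof
    assume "onorm ((*v) A) \<le> 1"
    then show "\<forall>x. norm (A *v x) \<le> norm x"
      using onorm[OF matrix_vector_mul_bounded_linear, of A]
      by (metis mult_1 mult_right_mono norm_ge_zero order_trans)
  next
    assume "\<forall>x. norm (A *v x) \<le> norm x"
    then show "onorm ((*v) A) \<le> 1" by (intro onorm_le) simp
  qed
  then show ?thesis by (auto simp: B_inf_inf_def)
qed

lemma linear_submatrix_apply: "linear (\<lambda>\<Phi> :: real^2^'r::finite^'n::finite. \<Phi> $ n *v x)"
  by (rule linearI) (simp_all add: matrix_vector_mult_add_rdistrib scaleR_matrix_vector_assoc)

lemma convex_B_inf_inf: "convex B_inf_inf"
  unfolding B_inf_inf_eq_vimage
  by (intro convex_INT convex_linear_vimage linear_submatrix_apply convex_cball)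

lemma closed_B_inf_inf: "closed B_inf_inf"
  unfolding B_inf_inf_eq_vimage
  by (intro closed_INT ballI closed_vimage closed_cball linear_continuous_on
      linear_conv_bounded_linear[THEN iffD1] linear_submatrix_apply)

section \<open>The norm of the patch-based Jacobian\<close>

lemma sum_full_period:
  fixes F :: "int \<Rightarrow> 'a::comm_monoid_add"
  assumes p: "p > 0"
  shows "(\<Sum>x=c..<c + p. F (x mod p)) = (\<Sum>r=0..<p. F r)"
proof (rule sum.reindex_bij_betw)
  have "inj_on (\<lambda>x. x mod p) {c..<c + p}"
  proof (rule inj_onI)
    fix x y assume xy: "x \<in> {c..<c + p}" "y \<in> {c..<c + p}" "x mod p = y mod p"
    then have "p dvd x - y" by (simp add: mod_eq_dvd_iff)
    moreover have "\<bar>x - y\<bar> < p" using xy by auto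
    ultimately show "x = y" using zdvd_not_zless[of "\<bar>x - y\<bar>" p] by fastforce
  qed
  moreover have "(\<lambda>x. x mod p) ` {c..<c + p} = {0..<p}"
  proof (rule card_seteq)
    show "(\<lambda>x. x mod p) ` {c..<c + p} \<subseteq> {0..<p}" using p by auto
    show "card {0..<p} \<le> card ((\<lambda>x. x mod p) ` {c..<c + p})"
      using calculation by (simp add: card_image)
  qed simp
  ultimately show "bij_betw (\<lambda>x. x mod p) {c..<c + p} {0..<p}"
    by (simp add: bij_betw_def)
qed

lemma sum_shift_int:
  fixes F :: "int \<Rightarrow> 'a::comm_monoid_add"
  shows "(\<Sum>x=a..b. F (x - k)) = (\<Sum>x=a - k..b - k. F x)"
  by (rule sum.reindex_bij_witness[of _ "\<lambda>x. x + k" "\<lambda>x. x - k"]) auto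

lemma sum_wrap:
  fixes F :: "int \<Rightarrow> 'a::comm_monoid_add"
  assumes "a \<le> b"
  shows "(\<Sum>x=a..b. F (wrap a b (x - k))) = (\<Sum>x=a..b. F x)"
proof -
  have "(\<Sum>x=a..b. F (wrap a b (x - k))) = (\<Sum>x=a - (a + k)..b - (a + k). F (a + x mod (b - a + 1)))"
    by (subst sum_shift_int[symmetric]) (simp add: wrap_def algebra_simps)
  also have "{a - (a + k)..b - (a + k)} = {- k..<- k + (b - a + 1)}" by auto
  also have "(\<Sum>x=- k..<- k + (b - a + 1). F (a + x mod (b - a + 1))) = (\<Sum>r=0..<b - a + 1. F (a + r))"
    using assms by (intro sum_full_period) simp
  also have "\<dots> = (\<Sum>x=a..b. F x)"
    by (rule sum.reindex_bij_witness[of _ "\<lambda>x. x - a" "\<lambda>x. a + x"]) auto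
  finally show ?thesis .
qed

text \<open>The symmetry about \<open>a - 1/2\<close> exchanges the remainders \<open>r\<close> and \<open>p - 1 - r\<close> modulo the period
  \<open>p = 2 (b - a + 1)\<close>, and these two are folded onto the same pixel.\<close>

lemma reflect_mirror:
  assumes "a \<le> b"
  shows "reflect a b (2 * a - 1 - y) = reflect a b y"
proof -
  define p where "p = 2 * (b - a + 1)"
  have p: "p > 0" using assms by (simp add: p_def)
  define r where "r = (y - a) mod p"
  have r: "0 \<le> r" "r < p" using p by (auto simp: r_def)
  have "(2 * a - 1 - y - a) mod p = (- 1 - r) mod p"
    unfolding r_def by (metis (no_types) diff_diff_eq2 mod_diff_right_eq add.commute add_diff_cancel_right'
        diff_add_eq diff_diff_add mult_2 uminus_add_conv_diff)
  also have "\<dots> = (p - 1 - r) mod p"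
    by (metis add_diff_eq diff_conv_add_uminus mod_add_self1 add.assoc)
  also have "\<dots> = p - 1 - r"
    using r by (intro mod_pos_pos_trivial) auto
  finally show ?thesis
    unfolding reflect_def Let_def p_def[symmetric] r_def[symmetric] using r
    by (auto simp: p_def)
qed

text \<open>Mirroring turns the translates \<open>x + k\<close> of the interval into the translates by \<open>- k\<close> of its mirror
  image \<open>{2 * a - 1 - b..a - 1}\<close>, which is adjacent to \<open>{a..b}\<close>.  Together they make up one full
  period, on which the reflection takes every value twice.\<close>

lemma sum_reflect:
  fixes F :: "int \<Rightarrow> real"
  assumes ab: "a \<le> b"
  shows "(\<Sum>x=a..b. F (reflect a b (x - k))) + (\<Sum>x=a..b. F (reflect a b (x + k))) =
    2 * (\<Sum>x=a..b. F x)"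
proof -
  define n where "n = b - a + 1"
  define H where "H r = F (a + (if r < n then r else 2 * n - 1 - r))" for r
  have n: "n > 0" using ab by (simp add: n_def)
  have refl: "F (reflect a b y) = H ((y - a) mod (2 * n))" for y
    by (simp add: reflect_def H_def n_def Let_def)
  have "(\<Sum>x=a..b. F (reflect a b (x + k))) = (\<Sum>x=2 * a - 1 - b..a - 1. F (reflect a b (x - k)))"
  proof (rule sum.reindex_bij_witness[of _ "\<lambda>x. 2 * a - 1 - x" "\<lambda>x. 2 * a - 1 - x"])
    fix x
    show "F (reflect a b (2 * a - 1 - x - k)) = F (reflect a b (x + k))"
      using reflect_mirror[OF ab, of "x + k"] by (simp add: algebra_simps)
  qed auto
  also have "(\<Sum>x=a..b. F (reflect a b (x - k))) + \<dots> =
      (\<Sum>x\<in>{a..b} \<union> {2 * a - 1 - b..a - 1}. F (reflect a b (x - k)))"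
    by (intro sum.union_disjoint[symmetric]) auto
  also have "{a..b} \<union> {2 * a - 1 - b..a - 1} = {2 * a - 1 - b..b}"
    using ab by auto
  also have "(\<Sum>x=2 * a - 1 - b..b. F (reflect a b (x - k))) =
      (\<Sum>x=2 * a - 1 - b - (a + k)..b - (a + k). H (x mod (2 * n)))"
    by (subst sum_shift_int[symmetric]) (simp add: refl algebra_simps)
  also have "{2 * a - 1 - b - (a + k)..b - (a + k)} = {- n - k..<- n - k + 2 * n}"
    by (auto simp: n_def)
  also have "(\<Sum>x=- n - k..<- n - k + 2 * n. H (x mod (2 * n))) = (\<Sum>r=0..<2 * n. H r)"
    using n by (intro sum_full_period) simp
  also have "{0..<2 * n} = {0..<n} \<union> {n..<2 * n}"
    using n by auto
  also have "sum H \<dots> = (\<Sum>r=0..<n. H r) + (\<Sum>r=n..<2 * n. H r)"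
    by (intro sum.union_disjoint) auto
  also have "(\<Sum>r=0..<n. H r) = (\<Sum>x=a..b. F x)"
    by (rule sum.reindex_bij_witness[of _ "\<lambda>x. x - a" "\<lambda>x. a + x"]) (auto simp: n_def H_def)
  also have "(\<Sum>r=n..<2 * n. H r) = (\<Sum>x=a..b. F x)"
    by (rule sum.reindex_bij_witness[of _ "\<lambda>x. 2 * n - 1 + a - x" "\<lambda>r. a + (2 * n - 1 - r)"])
      (auto simp: n_def H_def)
  finally show ?thesis by simp
qed

lemma patch_kernelD:
  assumes "patch_kernel LK K"
  shows "(x, y) \<in> offsets LK \<Longrightarrow> 0 < K (x, y)"
    "(x, y) \<in> offsets LK \<Longrightarrow> K (- x, y) = K (x, y)"
    "(x, y) \<in> offsets LK \<Longrightarrow> K (x, - y) = K (x, y)"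
    "sum K (offsets LK) = 1"
  using assms unfolding patch_kernel_def by blast+

lemma finite_offsets: "finite (offsets LK)"
  by (simp add: offsets_def)

lemma patch_average_symmetrize:
  assumes K: "patch_kernel LK K"
  shows "(\<Sum>(x, y)\<in>offsets LK. K (x, y) * T (- x) y) = (\<Sum>(x, y)\<in>offsets LK. K (x, y) * T x y)"
    and "(\<Sum>(x, y)\<in>offsets LK. K (x, y) * T x (- y)) = (\<Sum>(x, y)\<in>offsets LK. K (x, y) * T x y)"
proof -
  show "(\<Sum>(x, y)\<in>offsets LK. K (x, y) * T (- x) y) = (\<Sum>(x, y)\<in>offsets LK. K (x, y) * T x y)"
    by (rule sum.reindex_bij_witness[of _ "\<lambda>(x, y). (- x, y)" "\<lambda>(x, y). (- x, y)"])
      (auto simp: patch_kernelD(2)[OF K], auto simp: offsets_def)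
  show "(\<Sum>(x, y)\<in>offsets LK. K (x, y) * T x (- y)) = (\<Sum>(x, y)\<in>offsets LK. K (x, y) * T x y)"
    by (rule sum.reindex_bij_witness[of _ "\<lambda>(x, y). (x, - y)" "\<lambda>(x, y). (x, - y)"])
      (auto simp: patch_kernelD(3)[OF K], auto simp: offsets_def)
qed

lemma patch_average_const:
  assumes K: "patch_kernel LK K"
  shows "(\<Sum>(x, y)\<in>offsets LK. K (x, y) * c) = c"
  using patch_kernelD(4)[OF K] by (simp add: case_prod_unfold flip: sum_distrib_right)

text \<open>The two coordinates are treated one after the other: averaging over the sign of the first offset
  removes the reflection in the first coordinate, leaving \<open>U\<close>; the sign of the second offset then
  removes the other one.\<close>

lemma patch_average_reflect:
  fixes Q :: "int \<Rightarrow> int \<Rightarrow> real"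
  assumes K: "patch_kernel LK K" and ab: "a1 \<le> b1" "a2 \<le> b2"
  shows "(\<Sum>(k1, k2)\<in>offsets LK. K (k1, k2) *
      (\<Sum>x1=a1..b1. \<Sum>x2=a2..b2. Q (reflect a1 b1 (x1 - k1)) (reflect a2 b2 (x2 - k2)))) =
    (\<Sum>x1=a1..b1. \<Sum>x2=a2..b2. Q x1 x2)"
proof -
  define T where "T k1 k2 =
    (\<Sum>x1=a1..b1. \<Sum>x2=a2..b2. Q (reflect a1 b1 (x1 - k1)) (reflect a2 b2 (x2 - k2)))" for k1 k2
  define U where "U k2 = (\<Sum>x1=a1..b1. \<Sum>x2=a2..b2. Q x1 (reflect a2 b2 (x2 - k2)))" for k2
  define V where "V = (\<Sum>x1=a1..b1. \<Sum>x2=a2..b2. Q x1 x2)"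
  define A where "A F = (\<Sum>(k1, k2)\<in>offsets LK. K (k1, k2) * F k1 k2)" for F :: "int \<Rightarrow> int \<Rightarrow> real"
  have A_add: "A (\<lambda>k1 k2. F k1 k2 + G k1 k2) = A F + A G" for F G
    by (simp add: A_def case_prod_unfold distrib_left sum.distrib)
  have A_mult: "A (\<lambda>k1 k2. 2 * F k1 k2) = 2 * A F" for F
    by (simp add: A_def case_prod_unfold sum_distrib_left ac_simps)
  have T: "T k1 k2 + T (- k1) k2 = 2 * U k2" for k1 k2
    using sum_reflect[OF ab(1), of "\<lambda>y. \<Sum>x2=a2..b2. Q y (reflect a2 b2 (x2 - k2))" k1]
    by (simp add: T_def U_def)
  have U: "U k2 + U (- k2) = 2 * V" for k2
  proof -
    have "U k2 + U (- k2) = (\<Sum>x1=a1..b1. (\<Sum>x2=a2..b2. Q x1 (reflect a2 b2 (x2 - k2))) +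
        (\<Sum>x2=a2..b2. Q x1 (reflect a2 b2 (x2 + k2))))"
      by (simp add: U_def sum.distrib)
    also have "\<dots> = 2 * V"
      by (simp add: V_def sum_reflect[OF ab(2)] sum_distrib_left)
    finally show ?thesis .
  qed
  have "A T + A T = A (\<lambda>k1 k2. T k1 k2 + T (- k1) k2)"
    using patch_average_symmetrize(1)[OF K, of T] by (simp add: A_add) (simp add: A_def)
  then have "A T = A (\<lambda>_. U)"
    by (simp add: T A_mult)
  moreover have "A (\<lambda>_. U) + A (\<lambda>_. U) = A (\<lambda>k1 k2. U k2 + U (- k2))"
    using patch_average_symmetrize(2)[OF K, of "\<lambda>_. U"] by (simp add: A_add) (simp add: A_def)
  then have "A (\<lambda>_. U) = A (\<lambda>_ _. V)"
    by (simp add: U A_mult[of "\<lambda>_ _. V"])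
  moreover have "A (\<lambda>_ _. V) = V"
    using patch_average_const[OF K] by (simp add: A_def)
  ultimately show ?thesis
    by (simp add: A_def T_def V_def)
qed

lemma sum_rect: "(\<Sum>y\<in>rect a b. F y) = (\<Sum>x1=fst a..fst b. \<Sum>x2=snd a..snd b. F (x1, x2))"
  by (simp add: rect_def sum.cartesian_product)

lemma patch_average_extend_le:
  fixes pos :: "'n::finite \<Rightarrow> int \<times> int" and v :: "('b::real_normed_vector)^'n"
  assumes grid: "is_grid a b pos" and K: "patch_kernel LK K"
  shows "(\<Sum>k\<in>offsets LK. K k * (\<Sum>i\<in>UNIV. (norm (extend bc a b pos v (pos i - k)))\<^sup>2))
    \<le> (\<Sum>i\<in>UNIV. (norm (v $ i))\<^sup>2)"
proof -
  have bij: "bij_betw pos UNIV (rect a b)" using grid by (simp add: is_grid_def)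
  then have inj: "inj pos" and range: "range pos = rect a b" by (auto simp: bij_betw_def)
  have reindex: "(\<Sum>i\<in>UNIV. F (pos i)) = (\<Sum>y\<in>rect a b. F y)" for F :: "_ \<Rightarrow> real"
    by (rule sum.reindex_bij_betw[OF bij])
  have ab: "fst a \<le> fst b" "snd a \<le> snd b"
    using rangeI[of pos undefined] unfolding range by (auto simp: rect_def)
  define q where "q y = (norm (v $ inv pos y))\<^sup>2" for y
  have V: "(\<Sum>i\<in>UNIV. (norm (v $ i))\<^sup>2) = (\<Sum>y\<in>rect a b. q y)"
    using reindex[of q] inj by (simp add: q_def)
  define E where "E k = (\<Sum>y\<in>rect a b. (norm (extend bc a b pos v (y - k)))\<^sup>2)" for k
  have E: "(\<Sum>i\<in>UNIV. (norm (extend bc a b pos v (pos i - k)))\<^sup>2) = E k" for k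
    unfolding E_def by (rule reindex)
  have avg: "(\<Sum>k\<in>offsets LK. K k * E k) \<le> (\<Sum>y\<in>rect a b. q y)"
    if "\<And>k. E k \<le> (\<Sum>y\<in>rect a b. q y)"
  proof -
    have "(\<Sum>k\<in>offsets LK. K k * E k) \<le> (\<Sum>k\<in>offsets LK. K k * (\<Sum>y\<in>rect a b. q y))"
      using patch_kernelD(1)[OF K] that by (intro sum_mono mult_left_mono) (auto simp: less_imp_le)
    then show ?thesis
      using patch_kernelD(4)[OF K] by (simp flip: sum_distrib_right)
  qed
  have "(\<Sum>k\<in>offsets LK. K k * E k) \<le> (\<Sum>y\<in>rect a b. q y)"
  proof (cases bc)
    case Zero_Extension
    show ?thesis
    proof (rule avg)
      fix k
      have "E k = (\<Sum>y\<in>rect a b. if y - k \<in> rect a b then q (y - k) else 0)"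
        unfolding E_def by (intro sum.cong) (auto simp: extend_def Zero_Extension q_def)
      also have "\<dots> = (\<Sum>y\<in>{y\<in>rect a b. y - k \<in> rect a b}. q (y - k))"
        by (simp add: sum.inter_filter rect_def)
      also have "\<dots> = (\<Sum>y\<in>(\<lambda>y. y - k) ` {y\<in>rect a b. y - k \<in> rect a b}. q y)"
        by (subst sum.reindex) (auto simp: inj_on_def)
      also have "\<dots> \<le> (\<Sum>y\<in>rect a b. q y)"
        by (intro sum_mono2) (auto simp: rect_def q_def)
      finally show "E k \<le> (\<Sum>y\<in>rect a b. q y)" .
    qed
  next
    case Periodic_Extension
    show ?thesis
    proof (rule avg)
      fix k :: "int \<times> int"
      obtain k1 k2 where k: "k = (k1, k2)" by (cases k)
      have "E k = (\<Sum>x1=fst a..fst b. \<Sum>x2=snd a..snd b.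
          q (wrap (fst a) (fst b) (x1 - k1), wrap (snd a) (snd b) (x2 - k2)))"
        by (simp add: E_def sum_rect extend_def Periodic_Extension q_def k)
      also have "\<dots> = (\<Sum>y\<in>rect a b. q y)"
        by (simp add: sum_rect sum_wrap[OF ab(2), of "\<lambda>y. q (_, y)"]
            sum_wrap[OF ab(1), of "\<lambda>y. \<Sum>x2=snd a..snd b. q (y, x2)"])
      finally show "E k \<le> (\<Sum>y\<in>rect a b. q y)" by simp
    qed
  next
    case Symmetric_Extension
    have "E (k1, k2) = (\<Sum>x1=fst a..fst b. \<Sum>x2=snd a..snd b.
        q (reflect (fst a) (fst b) (x1 - k1), reflect (snd a) (snd b) (x2 - k2)))" for k1 k2
      by (simp add: E_def sum_rect extend_def Symmetric_Extension q_def)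
    then have "(\<Sum>(k1, k2)\<in>offsets LK. K (k1, k2) * E (k1, k2)) = (\<Sum>y\<in>rect a b. q y)"
      using patch_average_reflect[OF K ab, of "\<lambda>x y. q (x, y)"] by (simp add: sum_rect)
    then show ?thesis by simp
  qed
  then show ?thesis by (simp add: E V)
qed

lemma norm_vec_sq:
  fixes x :: "('b::real_normed_vector)^'n::finite"
  shows "(norm x)\<^sup>2 = (\<Sum>i\<in>UNIV. (norm (x $ i))\<^sup>2)"
  by (simp add: norm_vec_def L2_set_def sum_nonneg)

text \<open>By \<open>(p - q)\<^sup>2 \<le> 2 p\<^sup>2 + 2 q\<^sup>2\<close>; every pixel is the forward neighbour of at most one other.\<close>

lemma norm_forward_diff:
  assumes inj: "inj pos"
  shows "(norm (forward_diff e pos w))\<^sup>2 \<le> 4 * (norm w)\<^sup>2"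
proof -
  define S where "S = {i. pos i + e \<in> range pos}"
  define n where "n i = inv pos (pos i + e)" for i
  have n: "pos (n i) = pos i + e" if "i \<in> S" for i
    using that by (simp add: S_def n_def f_inv_into_f)
  have inj_n: "inj_on n S"
    by (rule inj_onI) (metis n add_right_cancel inj injD)
  have "(norm (forward_diff e pos w))\<^sup>2 = (\<Sum>i\<in>UNIV. if i \<in> S then (w $ n i - w $ i)\<^sup>2 else 0)"
    unfolding norm_vec_sq by (intro sum.cong) (auto simp: forward_diff_def S_def n_def)
  also have "\<dots> = (\<Sum>i\<in>S. (w $ n i - w $ i)\<^sup>2)"
    by (simp add: sum.If_cases)
  also have "\<dots> \<le> (\<Sum>i\<in>S. 2 * (w $ n i)\<^sup>2 + 2 * (w $ i)\<^sup>2)"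
  proof (rule sum_mono)
    fix i
    have "0 \<le> (w $ n i + w $ i)\<^sup>2" by simp
    then show "(w $ n i - w $ i)\<^sup>2 \<le> 2 * (w $ n i)\<^sup>2 + 2 * (w $ i)\<^sup>2"
      by (simp add: power2_eq_square algebra_simps)
  qed
  also have "\<dots> = 2 * (\<Sum>i\<in>n ` S. (w $ i)\<^sup>2) + 2 * (\<Sum>i\<in>S. (w $ i)\<^sup>2)"
    using inj_n by (simp add: sum.reindex sum.distrib sum_distrib_left)
  also have "\<dots> \<le> 2 * (\<Sum>i\<in>UNIV. (w $ i)\<^sup>2) + 2 * (\<Sum>i\<in>UNIV. (w $ i)\<^sup>2)"
    by (intro add_mono mult_left_mono sum_mono2) auto
  also have "\<dots> = 4 * (norm w)\<^sup>2"
    by (simp add: norm_vec_sq)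
  finally show ?thesis .
qed

lemma norm_grad:
  assumes "inj pos"
  shows "(norm (grad pos w))\<^sup>2 \<le> 8 * (norm w)\<^sup>2"
proof -
  have "(norm (grad pos w))\<^sup>2 = (norm (forward_diff (1, 0) pos w))\<^sup>2 + (norm (forward_diff (0, 1) pos w))\<^sup>2"
    by (simp add: norm_vec_sq grad_def sum_2 sum.distrib)
  then show ?thesis
    using norm_forward_diff[OF assms, of "(1, 0)" w] norm_forward_diff[OF assms, of "(0, 1)" w] by simp
qed

lemma abs_weights_le_1:
  assumes "\<kappa> \<ge> 0"
  shows "\<bar>weights \<kappa> s R bc a b pos f $ m $ i $ c\<bar> \<le> 1"
proof -
  have "\<bar>1 / (1 + \<kappa> * \<bar>y\<bar>)\<bar> \<le> 1" for y
  proof -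
    have "0 \<le> \<kappa> * \<bar>y\<bar>" using assms by simp
    then show ?thesis by (simp add: field_simps)
  qed
  moreover have "c = 1 \<or> c = 2" by (rule exhaust_2)
  ultimately show ?thesis by (auto simp: weights_def)
qed

lemma norm_apply_weights:
  assumes "\<And>i c. \<bar>w $ i $ c\<bar> \<le> 1"
  shows "(norm (apply_weights w v))\<^sup>2 \<le> (norm v)\<^sup>2"
proof -
  have "(w $ i $ c * v $ i $ c)\<^sup>2 \<le> (v $ i $ c)\<^sup>2" for i c
    using assms[of i c] by (subst abs_le_square_iff[symmetric]) (simp add: abs_mult mult_left_le_one_le)
  then show ?thesis
    by (simp add: norm_vec_sq apply_weights_def sum_mono)
qed

lemma norm_patch_jacobian:
  fixes pos :: "'n::finite \<Rightarrow> int \<times> int" and u :: "real^'n^'m::finite" and g :: "'l::finite \<Rightarrow> int \<times> int"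
  assumes grid: "is_grid a b pos" and K: "patch_kernel LK K" and g: "bij_betw g UNIV (offsets LK)"
    and w: "\<And>m i c. \<bar>w $ m $ i $ c\<bar> \<le> 1"
  shows "(norm (patch_jacobian bc a b pos K g w u))\<^sup>2 \<le> 8 * (norm u)\<^sup>2"
proof -
  define v where "v m = apply_weights (w $ m) (grad pos (u $ m))" for m
  define E where "E m k = (\<Sum>i\<in>UNIV. (norm (extend bc a b pos (v m) (pos i - k)))\<^sup>2)" for m k
  have K_nonneg: "0 \<le> K (g l)" for l
  proof -
    have "g l \<in> offsets LK" using g by (auto simp: bij_betw_def)
    then show ?thesis using patch_kernelD(1)[OF K, of "fst (g l)" "snd (g l)"] by simp
  qed
  have inj: "inj pos" using grid by (simp add: is_grid_def bij_betw_def)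
  have "(norm (patch_jacobian bc a b pos K g w u))\<^sup>2 =
      (\<Sum>i\<in>UNIV. \<Sum>(m, l)\<in>UNIV. K (g l) * (norm (extend bc a b pos (v m) (pos i - g l)))\<^sup>2)"
    unfolding norm_vec_sq[of "patch_jacobian bc a b pos K g w u"]
      norm_vec_sq[of "patch_jacobian bc a b pos K g w u $ _"]
    by (simp add: patch_jacobian_def weighted_translation_def v_def
        power_mult_distrib K_nonneg case_prod_unfold)
  also have "\<dots> = (\<Sum>(m, l)\<in>UNIV \<times> UNIV. K (g l) * E m (g l))"
    by (subst sum.swap) (simp add: E_def sum_distrib_left case_prod_unfold)
  also have "\<dots> = (\<Sum>m\<in>UNIV. \<Sum>l\<in>UNIV. K (g l) * E m (g l))"
    by (rule sum.cartesian_product[symmetric])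
  also have "\<dots> = (\<Sum>m\<in>UNIV. \<Sum>k\<in>offsets LK. K k * E m k)"
    by (simp add: sum.reindex_bij_betw[OF g, of "\<lambda>k. K k * E _ k"])
  also have "\<dots> \<le> (\<Sum>m\<in>UNIV. (norm (v m))\<^sup>2)"
    unfolding E_def norm_vec_sq[of "v _"] by (intro sum_mono patch_average_extend_le[OF grid K])
  also have "\<dots> \<le> (\<Sum>m\<in>UNIV. 8 * (norm (u $ m))\<^sup>2)"
    unfolding v_def using w norm_grad[OF inj]
    by (intro sum_mono order_trans[OF norm_apply_weights]) auto
  also have "\<dots> = 8 * (norm u)\<^sup>2"
    by (simp add: norm_vec_sq[of u] sum_distrib_left)
  finally show ?thesis .
qed

lemma linear_patch_jacobian:
  fixes pos :: "'n::finite \<Rightarrow> int \<times> int" and w :: "(real^2)^'n^'m::finite"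
  shows "linear (patch_jacobian bc a b pos K g w)"
proof (rule linearI)
  fix u u' :: "real^'n^'m" and r :: real
  have D: "forward_diff e pos (p + p') = forward_diff e pos p + forward_diff e pos p'"
    "forward_diff e pos (r *\<^sub>R p) = r *\<^sub>R forward_diff e pos p" for e and p p' :: "real^'n"
    by (simp_all add: forward_diff_def vec_eq_iff algebra_simps)
  have G: "apply_weights w (grad pos (p + p')) = apply_weights w (grad pos p) + apply_weights w (grad pos p')"
    "apply_weights w (grad pos (r *\<^sub>R p)) = r *\<^sub>R apply_weights w (grad pos p)" for w and p p' :: "real^'n"
    by (simp_all add: apply_weights_def grad_def D vec_eq_iff forall_2 algebra_simps)
  have X: "extend bc a b pos (v + v') y = extend bc a b pos v y + extend bc a b pos v' y"
    "extend bc a b pos (r *\<^sub>R v) y = r *\<^sub>R extend bc a b pos v y" for v v' :: "(real^2)^'n" and y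
    by (cases bc; simp add: extend_def)+
  show "patch_jacobian bc a b pos K g w (u + u') =
      patch_jacobian bc a b pos K g w u + patch_jacobian bc a b pos K g w u'"
    unfolding patch_jacobian_def weighted_translation_def
    by (subst vec_eq_iff)+ (simp add: G X scaleR_add_right)
  show "patch_jacobian bc a b pos K g w (r *\<^sub>R u) = r *\<^sub>R patch_jacobian bc a b pos K g w u"
    unfolding patch_jacobian_def weighted_translation_def
    by (subst vec_eq_iff)+ (simp add: G X)
qed

section \<open>The convergence rate\<close>

theorem mainTheorem3:
  fixes a b :: "int \<times> int" and pos :: "'n::finite \<Rightarrow> int \<times> int"
    and \<kappa> s :: real and R :: enat and bcG bc :: boundary
    and LK :: nat and K :: "int \<times> int \<Rightarrow> real" and g :: "'l::finite \<Rightarrow> int \<times> int"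
    and f :: "real^'n^('m::finite)" and C :: "(real^'n^'m) set" and \<tau> :: real
    and J :: "real^'n^'m \<Rightarrow> real^2^('m \<times> 'l)^'n"
    and z :: "nat \<Rightarrow> real^'n^'m" and \<Phi> \<Theta> :: "nat \<Rightarrow> real^2^('m \<times> 'l)^'n" and t :: "nat \<Rightarrow> real"
  assumes grid: "is_grid a b pos"
    and kappa: "\<kappa> \<ge> 0" and sigma_hat: "s > 0"
    and K: "patch_kernel LK K"
    and g: "bij_betw g UNIV (offsets LK)"
    and J: "J = patch_jacobian bc a b pos K g (weights \<kappa> s R bcG a b pos f)"
    and tau: "\<tau> > 0"
    and C: "C \<noteq> {}" "closed C" "convex C"
    and init: "\<Phi> 0 = 0" "\<Theta> 1 = 0" "t 1 = 1"
    and z: "\<And>i. i \<ge> 1 \<Longrightarrow> z i = closest_point C (f - \<tau> *\<^sub>R adjoint J (\<Theta> i))"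
    and Phi: "\<And>i. i \<ge> 1 \<Longrightarrow>
      \<Phi> i = closest_point B_inf_inf (\<Theta> i + (1 / (8 * sqrt 2 * \<tau>)) *\<^sub>R J (z i))"
    and t: "\<And>i. i \<ge> 1 \<Longrightarrow> t (i + 1) = (1 + sqrt (1 + 4 * (t i)\<^sup>2)) / 2"
    and Theta: "\<And>i. i \<ge> 1 \<Longrightarrow>
      \<Theta> (i + 1) = \<Phi> i + ((t i - 1) / t (i + 1)) *\<^sub>R (\<Phi> i - \<Phi> (i - 1))"
  shows "\<forall>\<Phi>star. \<Phi>star \<in> B_inf_inf \<and>
        (\<forall>\<Psi>\<in>B_inf_inf. dual_objective C f \<tau> J \<Psi> \<le> dual_objective C f \<tau> J \<Phi>star) \<longrightarrow>
      (\<forall>i\<ge>1. dual_objective C f \<tau> J \<Phi>star - dual_objective C f \<tau> J (\<Phi> i)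
          \<le> 2 * (8 * sqrt 2 * \<tau>\<^sup>2) * (norm (\<Phi> 0 - \<Phi>star))\<^sup>2 / (real i + 1)\<^sup>2) \<and>
      (\<lambda>i. dual_objective C f \<tau> J \<Phi>star - dual_objective C f \<tau> J (\<Phi> i))
        \<in> O(\<lambda>i. 1 / (real i)\<^sup>2)"
proof -
  define L where "L = 8 * sqrt 2 * \<tau>\<^sup>2"
  define h where "h \<Psi> = - dual_objective C f \<tau> J \<Psi>" for \<Psi>
  define Z where "Z \<Psi> = closest_point C (f - \<tau> *\<^sub>R adjoint J \<Psi>)" for \<Psi>
  define G where "G \<Psi> = - \<tau> *\<^sub>R J (Z \<Psi>)" for \<Psi>
  have L: "L > 0" using tau by (simp add: L_def)
  have linear: "linear J" unfolding J by (rule linear_patch_jacobian)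
  have bound: "(norm (J u))\<^sup>2 \<le> (8 * sqrt 2) * (norm u)\<^sup>2" for u
  proof -
    have "(norm (J u))\<^sup>2 \<le> 8 * (norm u)\<^sup>2"
      unfolding J by (rule norm_patch_jacobian[OF grid K g]) (rule abs_weights_le_1[OF kappa])
    also have "\<dots> \<le> (8 * sqrt 2) * (norm u)\<^sup>2"
      by (intro mult_right_mono) auto
    finally show ?thesis .
  qed
  have lower: "h \<Psi> \<ge> h \<Theta> + G \<Theta> \<bullet> (\<Psi> - \<Theta>)" for \<Theta> \<Psi>
    using dual_objective_bounds(1)[OF C linear _ bound Z_def, of \<Psi> \<Theta>] by (simp add: h_def G_def)
  have upper: "h \<Psi> \<le> h \<Theta> + G \<Theta> \<bullet> (\<Psi> - \<Theta>) + L / 2 * (norm (\<Psi> - \<Theta>))\<^sup>2" for \<Theta> \<Psi>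
    using dual_objective_bounds(2)[OF C linear _ bound Z_def, of \<Theta> \<Psi>] by (simp add: h_def G_def L_def)
  have Phi': "\<Phi> i = closest_point B_inf_inf (\<Theta> i - (1 / L) *\<^sub>R G (\<Theta> i))" if "i \<ge> 1" for i
  proof -
    have "- ((1 / L) *\<^sub>R G (\<Theta> i)) = (1 / (8 * sqrt 2 * \<tau>)) *\<^sub>R J (z i)"
      using tau by (simp add: G_def Z_def z[OF that] L_def power2_eq_square)
    then show ?thesis
      unfolding Phi[OF that] by (metis diff_conv_add_uminus)
  qed
  show ?thesis
  proof (intro allI impI)
    fix \<Phi>star
    assume opt: "\<Phi>star \<in> B_inf_inf \<and>
      (\<forall>\<Psi>\<in>B_inf_inf. dual_objective C f \<tau> J \<Psi> \<le> dual_objective C f \<tau> J \<Phi>star)"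
    let ?gap = "\<lambda>i. dual_objective C f \<tau> J \<Phi>star - dual_objective C f \<tau> J (\<Phi> i)"
    define c where "c = 2 * (8 * sqrt 2 * \<tau>\<^sup>2) * (norm (\<Phi> 0 - \<Phi>star))\<^sup>2"
    have rate: "?gap i \<le> c / (real i + 1)\<^sup>2" if "i \<ge> 1" for i
      using fista_convergence_rate[OF convex_B_inf_inf closed_B_inf_inf L lower upper _ init(3) Phi' t
          Theta _ that, of \<Phi>star] opt init(1,2)
      by (simp add: h_def L_def c_def)
    \<comment> \<open>The big-O bound concerns the absolute value of the gap, so optimality of \<open>\<Phi>star\<close> enters here.\<close>
    have "?gap i \<ge> 0" if "i \<ge> 1" for i
    proof -
      have "\<Phi> i \<in> B_inf_inf"
        unfolding Phi[OF that] using opt by (intro closest_point_in_set closed_B_inf_inf) auto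
      then show ?thesis using opt by simp
    qed
    moreover have "c / (real i + 1)\<^sup>2 \<le> c * (1 / (real i)\<^sup>2)" if "i \<ge> 1" for i
    proof -
      have "c / (real i + 1)\<^sup>2 \<le> c / (real i)\<^sup>2"
        using that by (intro divide_left_mono power_mono mult_pos_pos) (auto simp: c_def)
      then show ?thesis by simp
    qed
    ultimately have "norm (?gap i) \<le> c * norm (1 / (real i)\<^sup>2)" if "i \<ge> 1" for i
      using rate[OF that] that by fastforce
    then have "?gap \<in> O(\<lambda>i. 1 / (real i)\<^sup>2)"
      by (intro bigoI[of _ c] eventually_sequentiallyI[of 1])
    with rate show "(\<forall>i\<ge>1. ?gap i \<le> 2 * (8 * sqrt 2 * \<tau>\<^sup>2) * (norm (\<Phi> 0 - \<Phi>star))\<^sup>2 / (real i + 1)\<^sup>2)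
        \<and> ?gap \<in> O(\<lambda>i. 1 / (real i)\<^sup>2)"
      by (auto simp: c_def)
  qed
qed

end
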